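(* Let $A\in\mathbb{R}^{N\times d}$ and $y\in\mathbb{R}^N$ satisfy: (a) there exists $x\in\mathbb{R}^d$ with $Ax=y$; (b) $y\neq 0$; (c) $\ker(A)\neq\{0\}$; (d) the problem $\min_{x:Ax=y}\|x\|_{\ell^1}$ has a unique minimizer $g^*$. Let $\mathcal{S}=\operatorname{supp}(g^* )$, $\mathcal{S}^c=\{1,\dots,d\}\setminus\mathcal{S}$, let $\varrho,\varrho^-,\tilde\varrho$ be the null space property constants of $(A,g^* )$ and $\kappa_*=\frac{\max_{i\in\mathcal{S}}|g^*_i|}{\min_{i\in\mathcal{S}}|g^*_i|}$. Let $D\in\mathbb{N}$ with $D\ge3$, $\gamma=\frac{D-2}{D}$, $\alpha>0$, and let $$x^\infty\in\operatorname*{arg\,min}_{x:Ax=y}D_{Q^D_\alpha}(x,0).$$ Then the following statements hold. 1. (Upper bound) Assume that $$\frac{\alpha}{\min_{i\in\mathcal{S}}|g^*_i|}<\left(\frac{(1-\varrho)\gamma}{4\varrho^-}\right)^{\frac1\gamma}.$$ Then $$\frac{\|x^\infty-g^*\|_{\ell^1}}{\alpha}\le|\mathcal{S}^c|(1+\tilde\varrho)\left[h_D(\varrho)+\frac{4\varrho^-}{\gamma(1-\varrho)^{\frac1\gamma+1}}\left(\frac{\alpha}{\min_{i\in\mathcal{S}}|g^*_i|}\right)^{\gamma}\right].$$ 2. (Lower bound) Assume in addition that $$\frac{\alpha}{\min_{i\in\mathcal{S}}|g^*_i|}\le\min\left\{\left(\frac{(1-\varrho)\gamma}{4\varrho^-}\right)^{\frac1\gamma},\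 \frac{(1-\varrho)^{\frac1\gamma}}{4(1+\tilde\varrho)|\mathcal{S}^c|},\ \left(\frac{\varrho}{\varrho+2^{2+\gamma}\tilde\varrho\gamma\kappa_*}\right)^{\frac1\gamma}\right\}.$$ Then $$\frac{\|x^\infty_{\mathcal{S}^c}-g^*_{\mathcal{S}^c}\|_{\ell^\infty}}{\alpha}\ge h_D(\varrho)-\frac{2(\varrho+2^{2+\gamma}\tilde\varrho\gamma\kappa_* )}{\gamma(1-\varrho)^{\frac1\gamma+1}}\left(\frac{\alpha}{\min_{i\in\mathcal{S}}|g^*_i|}\right)^{\gamma}.$$
   Context: For $x\in\mathbb{R}^d$ and $T\subset\{1,\dots,d\}$, $x_T=(x_i)_{i\in T}$ and $\operatorname{supp}(x)=\{i: x_i\ne 0\}$. For a differentiable strictly convex $F$, $D_F(p,q)=F(p)-F(q)-\langle\nabla F(q),p-q\rangle$. For an integer $D\ge3$, $$h_D:(-1,1)\to\mathbb{R},\quad h_D(z)=(1-z)^{-\frac{D}{D-2}}-(1+z)^{-\frac{D}{D-2}},$$ which is an increasing bijection onto $\mathbb{R}$ with inverse $h_D^{-1}$; $q_D(u)=\int_0^u h_D^{-1}(v)\,dv$; and $Q^D_\alpha(z)=\sum_{i=1}^d\alpha\,q_D(z_i/\alpha)$ for $z\in\mathbb{R}^d$, $\alpha>0$. Null space property constants of $(A,g^* )$ (with $\mathcal{S}=\operatorname{supp}(g^* )$): $$\varrho=\sup_{0\ne n\in\ker A}\frac{-\sum_{i\in\mathcal{S}}\operatorname{sign}(g^*_i)n_i}{\|n_{\mathcal{S}^c}\|_{\ell^1}},\quad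 \varrho^-=\sup_{0\ne n\in\ker A}\frac{\sum_{i\in\mathcal{S}:\operatorname{sign}(g^*_i)n_i<0}|n_i|}{\|n_{\mathcal{S}^c}\|_{\ell^1}},\quad \tilde\varrho=\sup_{0\ne n\in\ker A}\frac{\|n_{\mathcal{S}}\|_{\ell^1}}{\|n_{\mathcal{S}^c}\|_{\ell^1}}.$$ Under (a)–(d) these are well defined (one has $n_{\mathcal{S}^c}\neq0$ for all $0\ne n\in\ker A$), $0\le\varrho<1$, and $\varrho^-,\tilde\varrho\in[0,\infty)$. *)

theory Defs
  imports "HOL-Analysis.Analysis"
begin

definition supp :: "real ^ 'd \<Rightarrow> 'd set" where
  "supp x = {i. x $ i \<noteq> 0}"

definition l1_norm_on :: "'d::finite set \<Rightarrow> real ^ 'd \<Rightarrow> real" where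
  "l1_norm_on T x = (\<Sum>i\<in>T. \<bar>x $ i\<bar>)"

abbreviation l1_norm :: "real ^ 'd \<Rightarrow> real" where
  "l1_norm \<equiv> l1_norm_on UNIV"

text \<open>Only meaningful for nonempty \<open>T\<close>.\<close>

definition linf_norm_on :: "'d::finite set \<Rightarrow> real ^ 'd \<Rightarrow> real" where
  "linf_norm_on T x = Max ((\<lambda>i. \<bar>x $ i\<bar>) ` T)"

definition gradient :: "('a::real_inner \<Rightarrow> real) \<Rightarrow> 'a \<Rightarrow> 'a" where
  "gradient F q = (THE v. GDERIV F q :> v)"

definition bregman :: "('a::real_inner \<Rightarrow> real) \<Rightarrow> 'a \<Rightarrow> 'a \<Rightarrow> real" where
  "bregman F p q = F p - F q - gradient F q \<bullet> (p - q)"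

definition hD :: "nat \<Rightarrow> real \<Rightarrow> real" where
  "hD D z = (1 - z) powr (- (real D / (real D - 2))) - (1 + z) powr (- (real D / (real D - 2)))"

definition hD_inv :: "nat \<Rightarrow> real \<Rightarrow> real" where
  "hD_inv D = the_inv_into {-1<..<1} (hD D)"

text \<open>The interval integral is oriented, so this is also the intended value for \<open>u < 0\<close>.\<close>

definition qD :: "nat \<Rightarrow> real \<Rightarrow> real" where
  "qD D u = (LBINT v=ereal 0..ereal u. hD_inv D v)"

definition QD :: "nat \<Rightarrow> real \<Rightarrow> real ^ 'd \<Rightarrow> real" where
  "QD D \<alpha> z = (\<Sum>i\<in>UNIV. \<alpha> * qD D (z $ i / \<alpha>))"

definition nonzero_kernel :: "real ^ 'd ^ 'n \<Rightarrow> (real ^ 'd) set" where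
  "nonzero_kernel A = {n. n \<noteq> 0 \<and> A *v n = 0}"

text \<open>
  The null space property constants. When the \<open>\<ell>\<^sup>1\<close> problem has the unique minimizer \<open>g\<close> and
  the kernel of \<open>A\<close> is nontrivial, the denominators are nonzero and the suprema are finite, so
  the real-valued supremum is the intended one.
\<close>

definition nsp_const :: "real ^ 'd ^ 'n \<Rightarrow> real ^ 'd \<Rightarrow> real" where
  "nsp_const A g =
    (SUP n\<in>nonzero_kernel A. - (\<Sum>i\<in>supp g. sgn (g $ i) * n $ i) / l1_norm_on (- supp g) n)"

definition nsp_const_minus :: "real ^ 'd ^ 'n \<Rightarrow> real ^ 'd \<Rightarrow> real" where
  "nsp_const_minus A g =
    (SUP n\<in>nonzero_kernel A.
      (\<Sum>i\<in>{i \<in> supp g. sgn (g $ i) * n $ i < 0}. \<bar>n $ i\<bar>) / l1_norm_on (- supp g) n)"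

definition nsp_const_tilde :: "real ^ 'd ^ 'n \<Rightarrow> real ^ 'd \<Rightarrow> real" where
  "nsp_const_tilde A g =
    (SUP n\<in>nonzero_kernel A. l1_norm_on (supp g) n / l1_norm_on (- supp g) n)"

text \<open>
  \<open>(a / b)\<^sup>p\<close> for \<open>a, b \<ge> 0\<close> and \<open>p > 0\<close> as an upper threshold: a vanishing denominator means that
  there is no restriction, whereas real division would give the threshold \<open>0\<close>.
\<close>

definition ratio_powr :: "real \<Rightarrow> real \<Rightarrow> real \<Rightarrow> ereal" where
  "ratio_powr a b p = (if b = 0 then \<infinity> else ereal ((a / b) powr p))"

end

theory Submission
  imports Defs
begin

text \<open>
  Stationarity of \<open>xinf\<close> says that \<open>(h\<inverse> (xinf\<^sub>i / \<alpha>))\<^sub>i\<close> is orthogonal to the kernel of \<open>A\<close>. Testing it with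
  \<open>n = xinf - g\<close>, and using that \<open>h\<inverse>\<close> is monotone, odd and within \<open>(\<alpha> / gmin)\<^sup>\<gamma>\<close> of \<open>1\<close> beyond \<open>gmin / \<alpha>\<close>,
  gives \<open>\<Sum>t\<^sub>i h\<inverse> t\<^sub>i \<le> c \<Sum>t\<^sub>i\<close> for \<open>t\<^sub>i = \<bar>n\<^sub>i\<bar> / \<alpha>\<close> off the support, with \<open>c = \<rho> + \<rho>m (\<alpha> / gmin)\<^sup>\<gamma>\<close>.
  Since \<open>t h\<inverse> t\<close> is convex, the mean of the \<open>t\<^sub>i\<close> is at most \<open>h c\<close>, which is the upper bound up to a mean
  value estimate. For the lower bound, stationarity is tested with a kernel vector attaining \<open>\<rho>\<close>; by
  the upper bound \<open>xinf\<close> has at least half the size of \<open>g\<close> on the support, so that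
  \<open>h\<inverse> (\<parallel>n\<parallel>\<^sub>\<infinity> / \<alpha>) \<ge> \<rho> - \<rho>t (2 \<alpha> / gmin)\<^sup>\<gamma>\<close>, where the sup norm is taken off the support.
\<close>

subsection \<open>The potential and its derivative\<close>

text \<open>The function \<open>hD D\<close> with its exponent freed: \<open>p = D / (D - 2)\<close>
  gives \<open>hD D\<close>, so that \<open>p > 1\<close> and \<open>1 / p\<close> is the
  \<open>\<gamma>\<close> of the theorem.\<close>

definition hpow :: "real \<Rightarrow> real \<Rightarrow> real" where
  "hpow p z = (1 - z) powr - p - (1 + z) powr - p"

lemma hD_eq_hpow: "hD D = hpow (real D / (real D - 2))"
  by (simp add: fun_eq_iff hD_def hpow_def)

lemma hpow_0 [simp]: "hpow p 0 = 0"
  by (simp add: hpow_def)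

lemma hpow_minus: "hpow p (- z) = - hpow p z"
  by (simp add: hpow_def)

lemma DERIV_hpow:
  assumes "\<bar>z\<bar> < 1"
  shows "(hpow p has_real_derivative p * ((1 - z) powr (- p - 1) + (1 + z) powr (- p - 1))) (at z)"
  unfolding hpow_def using assms
  by (auto intro!: derivative_eq_intros simp: algebra_simps)

lemma DERIV_DERIV_hpow:
  assumes "\<bar>z\<bar> < 1"
  shows "((\<lambda>z. p * ((1 - z) powr (- p - 1) + (1 + z) powr (- p - 1))) has_real_derivative
    p * (p + 1) * ((1 - z) powr (- p - 2) - (1 + z) powr (- p - 2))) (at z)"
proof -
  have "- p - 1 - 1 = - p - 2" by simp
  then show ?thesis
    using assms by (auto intro!: derivative_eq_intros simp: algebra_simps)
qed

lemma hpow_strict_mono: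
  assumes "p > 0" "- 1 < a" "a < b" "b < 1"
  shows "hpow p a < hpow p b"
proof (rule DERIV_pos_imp_increasing[OF assms(3)])
  fix x assume "a \<le> x" "x \<le> b"
  then have "\<bar>x\<bar> < 1" using assms by auto
  moreover from this have "p * ((1 - x) powr (- p - 1) + (1 + x) powr (- p - 1)) > 0"
    using assms by (intro mult_pos_pos add_pos_pos) auto
  ultimately show "\<exists>y. (hpow p has_real_derivative y) (at x) \<and> 0 < y"
    using DERIV_hpow by blast
qed

lemma hpow_less_iff:
  assumes "p > 0" "\<bar>a\<bar> < 1" "\<bar>b\<bar> < 1"
  shows "hpow p a < hpow p b \<longleftrightarrow> a < b"
  using hpow_strict_mono[OF assms(1), of a b] hpow_strict_mono[OF assms(1), of b a] assms
  by (cases a b rule: linorder_cases) (auto simp: abs_less_iff)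

lemma hpow_le_iff:
  assumes "p > 0" "\<bar>a\<bar> < 1" "\<bar>b\<bar> < 1"
  shows "hpow p a \<le> hpow p b \<longleftrightarrow> a \<le> b"
  using hpow_less_iff[of p b a] assms by (auto simp: not_less[symmetric])

lemma isCont_hpow: "\<bar>z\<bar> < 1 \<Longrightarrow> isCont (hpow p) z"
  by (rule DERIV_isCont[OF DERIV_hpow])

lemma inj_on_hpow: "p > 0 \<Longrightarrow> inj_on (hpow p) {-1<..<1}"
  by (rule linorder_inj_onI') (use hpow_strict_mono in fastforce)

lemma hpow_surj_nonneg:
  assumes "p > 0" "u \<ge> 0"
  shows "\<exists>z. 0 \<le> z \<and> z < 1 \<and> hpow p z = u"
proof -
  \<comment> \<open>Chosen so that \<open>(1 - w) powr - p = u + 1\<close>; the subtracted term of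
    \<open>hpow p w\<close> is at most \<open>1\<close>, hence \<open>hpow p w \<ge> u\<close> and
    the intermediate value theorem applies on \<open>[0, w]\<close>.\<close>
  define w where "w = 1 - (u + 1) powr - (1 / p)"
  have w: "0 \<le> w" "w < 1"
    using assms powr_mono2'[of "- (1 / p)" 1 "u + 1"] by (auto simp: w_def)
  have "(1 + w) powr - p \<le> 1" using w assms powr_mono2'[of "- p" 1 "1 + w"] by simp
  moreover have "(1 - w) powr - p = u + 1"
    using assms by (simp add: w_def powr_powr)
  ultimately have "u \<le> hpow p w" by (simp add: hpow_def)
  then have "\<exists>z. 0 \<le> z \<and> z \<le> w \<and> hpow p z = u"
    using assms w by (intro IVT) (auto intro!: isCont_hpow)
  then show ?thesis using w by auto
qed

lemma bij_betw_hpow: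
  assumes "p > 0"
  shows "bij_betw (hpow p) {-1<..<1} UNIV"
proof -
  have "\<exists>z. \<bar>z\<bar> < 1 \<and> hpow p z = u" for u
  proof (cases "u \<ge> 0")
    case True
    then show ?thesis using hpow_surj_nonneg[OF assms, of u] by force
  next
    case False
    then obtain z where "0 \<le> z" "z < 1" "hpow p z = - u"
      using hpow_surj_nonneg[OF assms, of "- u"] by auto
    then show ?thesis by (intro exI[of _ "- z"]) (auto simp: hpow_minus)
  qed
  then have "u \<in> hpow p ` {-1<..<1}" for u
    by (metis abs_less_iff greaterThanLessThan_iff image_eqI minus_less_iff)
  then show ?thesis using inj_on_hpow[OF assms] by (auto simp: bij_betw_def)
qed

text \<open>Mean value theorem: both powers in the derivative have a base of at least
  \<open>1 - b\<close>, and their exponent is negative.\<close>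

lemma hpow_lipschitz:
  assumes "p > 0" "0 \<le> a" "a \<le> b" "b < 1"
  shows "hpow p b - hpow p a \<le> 2 * p * (1 - b) powr (- p - 1) * (b - a)"
proof (cases "a = b")
  case False
  then have "a < b" using assms by simp
  then obtain z where z: "a < z" "z < b"
    "hpow p b - hpow p a = (b - a) * (p * ((1 - z) powr (- p - 1) + (1 + z) powr (- p - 1)))"
    using MVT2[of a b "hpow p" "\<lambda>z. p * ((1 - z) powr (- p - 1) + (1 + z) powr (- p - 1))"]
      DERIV_hpow[of _ p] assms by auto
  have "(1 - z) powr (- p - 1) \<le> (1 - b) powr (- p - 1)"
    "(1 + z) powr (- p - 1) \<le> (1 - b) powr (- p - 1)"
    using z assms by (auto intro!: powr_mono2')
  then have "(b - a) * (p * ((1 - z) powr (- p - 1) + (1 + z) powr (- p - 1)))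
      \<le> (b - a) * (p * (2 * (1 - b) powr (- p - 1)))"
    using assms by (intro mult_left_mono) auto
  then show ?thesis using z by (simp add: algebra_simps)
qed auto

text \<open>The second derivative of \<open>1 / h\<close> is \<open>(2 h'^2 - h h'') / h^3\<close>.
  Discarding the \<open>1 + z\<close> terms, which lower \<open>h\<close> and \<open>h''\<close> but
  raise \<open>h'\<close>, reduces its nonnegativity to \<open>p (p + 1) \<le> 2 p^2\<close>, that
  is, to \<open>p \<ge> 1\<close>.\<close>

lemma convex_on_inverse_hpow:
  assumes "p \<ge> 1"
  shows "convex_on {0<..<1} (\<lambda>z. 1 / hpow p z)"
proof -
  define h' where "h' z = p * ((1 - z) powr (- p - 1) + (1 + z) powr (- p - 1))" for z
  define h'' where "h'' z = p * (p + 1) * ((1 - z) powr (- p - 2) - (1 + z) powr (- p - 2))" for z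
  have pos: "hpow p z > 0" if "z \<in> {0<..<1}" for z
    using hpow_strict_mono[of p 0 z] assms that by simp
  have d1: "(hpow p has_real_derivative h' z) (at z)" 
    and d2: "(h' has_real_derivative h'' z) (at z)" if "z \<in> {0<..<1}" for z
    using DERIV_hpow[of z p] DERIV_DERIV_hpow[of z p] that by (auto simp: h'_def[abs_def] h''_def)
  have key: "hpow p z * h'' z \<le> 2 * (h' z)\<^sup>2" if z: "z \<in> {0<..<1}" for z
  proof -
    have e: "(1 - z) powr - p * (1 - z) powr (- p - 2) = ((1 - z) powr (- p - 1))\<^sup>2"
      using z by (simp add: power2_eq_square flip: powr_add)
    have "h'' z \<le> p * (p + 1) * (1 - z) powr (- p - 2)"
      using assms by (auto simp: h''_def intro!: mult_left_mono)
    moreover have "hpow p z \<le> (1 - z) powr - p" by (simp add: hpow_def)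
    ultimately have "hpow p z * h'' z \<le> (1 - z) powr - p * (p * (p + 1) * (1 - z) powr (- p - 2))"
      using pos[OF z] z assms
      by (intro mult_mono') (auto intro!: mult_nonneg_nonneg powr_mono2' simp: h''_def)
    also have "\<dots> = p * (p + 1) * ((1 - z) powr (- p - 1))\<^sup>2"
      by (simp add: e[symmetric])
    also have "\<dots> \<le> 2 * p\<^sup>2 * ((1 - z) powr (- p - 1))\<^sup>2"
      using assms by (intro mult_right_mono) (auto simp: power2_eq_square algebra_simps)
    also have "\<dots> = 2 * (p * (1 - z) powr (- p - 1))\<^sup>2"
      by (simp add: power_mult_distrib)
    also have "\<dots> \<le> 2 * (h' z)\<^sup>2"
      using assms by (auto simp: h'_def intro!: power_mono mult_left_mono)
    finally show ?thesis .
  qed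
  show ?thesis
  proof (rule f''_ge0_imp_convex)
    fix z :: real assume z: "z \<in> {0<..<1}"
    show "((\<lambda>z. 1 / hpow p z) has_real_derivative - h' z / (hpow p z)\<^sup>2) (at z)"
      using pos[OF z] by (auto intro!: derivative_eq_intros d1 z simp: power2_eq_square)
    show "((\<lambda>z. - h' z / (hpow p z)\<^sup>2) has_real_derivative
        (2 * (h' z)\<^sup>2 - hpow p z * h'' z) / (hpow p z) ^ 3) (at z)"
      using pos[OF z]
      by (auto intro!: derivative_eq_intros d1 d2 z
           simp: field_simps power2_eq_square power3_eq_cube)
    show "0 \<le> (2 * (h' z)\<^sup>2 - hpow p z * h'' z) / (hpow p z) ^ 3"
      using pos[OF z] key[OF z] by simp
  qed auto
qed

text \<open>
  The tangent inequality at \<open>c\<close> of the convex function \<open>1 / h\<close>, multiplied by \<open>h z * h c\<close>; in terms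
  of \<open>t = h z\<close> it says that \<open>t * h\<inverse> t\<close> lies above its tangent at \<open>h c\<close>.
\<close>

lemma hpow_tangent:
  assumes "p \<ge> 1" "0 < c" "c < 1"
  shows "\<exists>l>0. \<forall>z. 0 \<le> z \<longrightarrow> z < 1 \<longrightarrow> l * (hpow p z - hpow p c) \<le> hpow p z * (z - c)"
proof -
  define h' where "h' = p * ((1 - c) powr (- p - 1) + (1 + c) powr (- p - 1))"
  have h': "h' > 0" unfolding h'_def
    using assms by (intro mult_pos_pos add_pos_pos) auto
  have pos: "hpow p z > 0" if "0 < z" "z < 1" for z
    using hpow_strict_mono[of p 0 z] assms that by simp
  have c: "hpow p c > 0" using pos assms by simp
  have d: "((\<lambda>z. 1 / hpow p z) has_real_derivative - h' / (hpow p c)\<^sup>2) (at c)"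
    using c DERIV_hpow[of c p] assms
    by (auto intro!: derivative_eq_intros simp: power2_eq_square h'_def)
  \<comment> \<open>The slope \<open>l = hpow p c / h'\<close> arises when the tangent inequality is
    multiplied by the square of \<open>hpow p c\<close> times \<open>hpow p z / h'\<close>. The
    point \<open>z = 0\<close> is separate, since \<open>1 / h\<close> has a pole there.\<close>
  have "hpow p c / h' * (hpow p z - hpow p c) \<le> hpow p z * (z - c)" if z: "0 \<le> z" "z < 1" for z
  proof (cases "z = 0")
    case True
    then show ?thesis using assms c h' by simp
  next
    case False
    then have hz: "hpow p z > 0" using pos z by simp
    have "- h' / (hpow p c)\<^sup>2 * (z - c) \<le> 1 / hpow p z - 1 / hpow p c"
      by (rule convex_on_imp_above_tangent[OF convex_on_inverse_hpow[OF assms(1)]])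
        (use assms z False has_field_derivative_at_within[OF d] in \<open>auto simp: interior_open\<close>)
    then have "hpow p c * (hpow p c * hpow p z / h') * (- h' / (hpow p c)\<^sup>2 * (z - c))
        \<le> hpow p c * (hpow p c * hpow p z / h') * (1 / hpow p z - 1 / hpow p c)"
      using hz c h' by (intro mult_left_mono) auto
    moreover have "hpow p c * (hpow p c * hpow p z / h') * (- h' / (hpow p c)\<^sup>2 * (z - c))
        = - (hpow p z * (z - c))"
      using hz c h' by (simp add: power2_eq_square)
    moreover have "hpow p c * (hpow p c * hpow p z / h') * (1 / hpow p z - 1 / hpow p c)
        = - (hpow p c / h' * (hpow p z - hpow p c))"
      using hz c h' by (simp add: field_simps)
    ultimately show ?thesis by linarith
  qed
  then show ?thesis using c h' by (intro exI[of _ "hpow p c / h'"]) auto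
qed

section \<open>The inverse of \<open>hD\<close> and stationarity of Bregman minimizers\<close>

context
  fixes D :: nat
  assumes D: "D \<ge> 3"
begin

lemma bij_betw_hD: "bij_betw (hD D) {-1<..<1} UNIV"
  using D by (auto simp: hD_eq_hpow intro!: bij_betw_hpow)

lemma hD_inv_bounds: "\<bar>hD_inv D u\<bar> < 1"
  using bij_betw_hD the_inv_into_into[of "hD D" "{-1<..<1}" u "{-1<..<1}"]
  by (auto simp: hD_inv_def bij_betw_def abs_less_iff)

lemma hD_hD_inv [simp]: "hD D (hD_inv D u) = u"
  using bij_betw_hD by (simp add: hD_inv_def f_the_inv_into_f_bij_betw)

lemma hD_inv_hD: "\<bar>z\<bar> < 1 \<Longrightarrow> hD_inv D (hD D z) = z"
  using bij_betw_hD by (auto simp: hD_inv_def bij_betw_def abs_less_iff intro!: the_inv_into_f_f)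

lemma hD_le_iff: "\<bar>a\<bar> < 1 \<Longrightarrow> \<bar>b\<bar> < 1 \<Longrightarrow> hD D a \<le> hD D b \<longleftrightarrow> a \<le> b"
  using D by (simp add: hD_eq_hpow hpow_le_iff)

lemma hD_inv_le_iff: "hD_inv D u \<le> hD_inv D v \<longleftrightarrow> u \<le> v"
  using hD_le_iff[OF hD_inv_bounds hD_inv_bounds, of u v] by simp

lemma hD_inv_minus: "hD_inv D (- u) = - hD_inv D u"
  using hD_inv_hD[of "- hD_inv D u"] hD_inv_bounds[of u] hD_hD_inv[of u]
  by (simp add: hD_eq_hpow hpow_minus)

lemma hD_inv_0 [simp]: "hD_inv D 0 = 0"
  using hD_inv_minus[of 0] by simp

lemma hD_inv_nonneg: "0 \<le> u \<Longrightarrow> 0 \<le> hD_inv D u"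
  using hD_inv_le_iff[of 0 u] by simp

lemma abs_hD_inv: "\<bar>hD_inv D u\<bar> = hD_inv D \<bar>u\<bar>"
  using hD_inv_nonneg[of u] hD_inv_nonneg[of "- u"] by (cases "u \<ge> 0") (auto simp: hD_inv_minus)

lemma hD_inv_mult_abs: "hD_inv D u * u = hD_inv D \<bar>u\<bar> * \<bar>u\<bar>"
  by (cases "u \<ge> 0") (auto simp: hD_inv_minus)

lemma isCont_hD_inv: "isCont (hD_inv D) u"
proof -
  define z where "z = hD_inv D u"
  \<comment> \<open>Midpoints between \<open>z\<close> and the ends of \<open>(-1, 1)\<close>: the
    closed interval \<open>[a, b]\<close> stays inside the domain on which \<open>hD D\<close> is
    continuous and injective.\<close>
  define a b where "a = (z - 1) / 2" and "b = (z + 1) / 2"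
  have z: "\<bar>z\<bar> < 1" using hD_inv_bounds by (simp add: z_def)
  then have ab: "- 1 < a" "a < z" "z < b" "b < 1" by (auto simp: a_def b_def)
  have "isCont (hD_inv D) (hD D z)"
  proof (rule isCont_inverse_function2[of a z b])
    fix w assume "a \<le> w" "w \<le> b"
    then have w: "\<bar>w\<bar> < 1" using ab by simp
    then show "hD_inv D (hD D w) = w" by (rule hD_inv_hD)
    show "isCont (hD D) w" unfolding hD_eq_hpow by (rule isCont_hpow[OF w])
  qed (use ab in auto)
  then show ?thesis by (simp add: z_def)
qed

lemma DERIV_qD: "(qD D has_real_derivative hD_inv D u) (at u)"
proof -
  \<comment> \<open>An interval that contains \<open>0\<close> and has \<open>u\<close> in its
    interior, so that the derivative within it is the full derivative.\<close>
  define a b where "a = - \<bar>u\<bar> - 1" and "b = \<bar>u\<bar> + 1"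
  have "((\<lambda>u. LBINT y=ereal 0..u. hD_inv D y) has_vector_derivative hD_inv D u)
      (at u within {a..b})"
    by (rule interval_integral_FTC2)
      (auto simp: a_def b_def intro!: continuous_at_imp_continuous_on isCont_hD_inv)
  moreover have "at u within {a..b} = at u"
    by (rule at_within_interior) (auto simp: a_def b_def)
  ultimately show ?thesis
    by (simp add: qD_def[abs_def] has_real_derivative_iff_has_vector_derivative)
qed

text \<open>With \<open>z = h\<inverse> u\<close>, dropping the subtracted term of
  \<open>h z = u\<close> leaves \<open>u \<le> (1 - z) powr - p\<close>, and the power
  \<open>- 1 / p\<close> reverses this. All powers \<open>\<gamma>\<close> of
  \<open>\<alpha> / gmin\<close> in the bounds come from here.\<close>

lemma one_minus_hD_inv_le:
  assumes "u > 0"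
  shows "1 - hD_inv D u \<le> (1 / u) powr ((real D - 2) / real D)"
proof -
  let ?p = "real D / (real D - 2)" and ?z = "hD_inv D u"
  have z: "\<bar>?z\<bar> < 1" by (rule hD_inv_bounds)
  have "u = hD D ?z" by simp
  also have "\<dots> \<le> (1 - ?z) powr - ?p" by (simp add: hD_def)
  finally have "((1 - ?z) powr - ?p) powr - (1 / ?p) \<le> u powr - (1 / ?p)"
    using assms D by (intro powr_mono2') auto
  then show ?thesis using z D assms by (simp add: powr_powr powr_minus powr_divide field_simps)
qed

lemma has_derivative_QD:
  fixes x :: "real ^ 'd"
  assumes "\<alpha> > 0"
  shows "(QD D \<alpha> has_derivative (\<lambda>h. \<Sum>i\<in>UNIV. hD_inv D (x $ i / \<alpha>) * h $ i)) (at x)"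
proof -
  have "((\<lambda>x. \<alpha> * qD D (x $ i / \<alpha>)) has_derivative (\<lambda>h. hD_inv D (x $ i / \<alpha>) * h $ i)) (at x)" for i
  proof -
    have "((\<lambda>x. x $ i / \<alpha>) has_derivative (\<lambda>h. h $ i / \<alpha>)) (at x)"
      by (intro bounded_linear_imp_has_derivative
          bounded_linear_compose[OF bounded_linear_divide bounded_linear_vec_nth])
    from has_derivative_compose[OF this, of "qD D" "(*) (hD_inv D (x $ i / \<alpha>))"]
    have "((\<lambda>x. qD D (x $ i / \<alpha>)) has_derivative (\<lambda>h. hD_inv D (x $ i / \<alpha>) * (h $ i / \<alpha>))) (at x)"
      using DERIV_qD by (auto simp: has_field_derivative_def)
    from has_derivative_mult_right[OF this, of \<alpha>] show ?thesis
      using assms by (simp add: algebra_simps)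
  qed
  then show ?thesis unfolding QD_def[abs_def] by (intro has_derivative_sum)
qed

text \<open>Since \<open>h\<inverse> 0 = 0\<close>, the gradient of \<open>QD D \<alpha>\<close>
  vanishes at \<open>0\<close>, so the divergence from \<open>0\<close> is the potential up to a
  constant.\<close>

lemma bregman_QD_0:
  fixes x :: "real ^ 'd"
  assumes "\<alpha> > 0"
  shows "bregman (QD D \<alpha>) x 0 = QD D \<alpha> x - QD D \<alpha> (0 :: real ^ 'd)"
proof -
  have *: "(QD D \<alpha> has_derivative (\<lambda>h. 0)) (at (0 :: real ^ 'd))"
    using has_derivative_QD[OF assms, of 0] by simp
  have "gradient (QD D \<alpha>) (0 :: real ^ 'd) = 0"
    unfolding gradient_def
  proof (rule the_equality)
    show "GDERIV (QD D \<alpha>) (0 :: real ^ 'd) :> 0" using * by (simp add: gderiv_def)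
    fix v assume "GDERIV (QD D \<alpha>) (0 :: real ^ 'd) :> v"
    then have "(\<lambda>h. h \<bullet> v) = (\<lambda>h. 0)"
      unfolding gderiv_def by (rule has_derivative_unique[OF _ *])
    then show "v = 0" by (metis inner_eq_zero_iff)
  qed
  then show ?thesis by (simp add: bregman_def)
qed

text \<open>The line \<open>x + t m\<close> stays feasible for \<open>m\<close> in the kernel, so
  \<open>t = 0\<close> minimizes the potential along it and the directional derivative
  vanishes.\<close>

lemma bregman_QD_minimizer_stationary:
  fixes A :: "real ^ 'd ^ 'n"
  assumes "\<alpha> > 0"
    and min: "is_arg_min (\<lambda>x. bregman (QD D \<alpha>) x 0) (\<lambda>x. A *v x = y) x"
    and m: "A *v m = 0"
  shows "(\<Sum>i\<in>UNIV. hD_inv D (x $ i / \<alpha>) * m $ i) = 0"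
proof -
  let ?f = "\<lambda>t. QD D \<alpha> (x + t *\<^sub>R m)"
  have Ax: "A *v x = y" using min by (simp add: is_arg_min_def)
  have "A *v (x + t *\<^sub>R m) = y" for t
    using Ax m by (simp add: matrix_vector_right_distrib matrix_vector_mult_scaleR)
  then have "bregman (QD D \<alpha>) x 0 \<le> bregman (QD D \<alpha>) (x + t *\<^sub>R m) 0" for t
    using min unfolding is_arg_min_def by (meson not_less)
  then have "\<forall>t. \<bar>0 - t\<bar> < 1 \<longrightarrow> ?f 0 \<le> ?f t"
    by (simp add: bregman_QD_0[OF assms(1)])
  moreover have "(?f has_real_derivative (\<Sum>i\<in>UNIV. hD_inv D (x $ i / \<alpha>) * m $ i)) (at 0)"
  proof -
    have 1: "((\<lambda>t. x + t *\<^sub>R m) has_derivative (\<lambda>t. t *\<^sub>R m)) (at 0)"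
      by (auto intro!: derivative_eq_intros)
    have "(?f has_derivative (\<lambda>t. \<Sum>i\<in>UNIV. hD_inv D (x $ i / \<alpha>) * (t *\<^sub>R m) $ i)) (at 0)"
      by (rule has_derivative_compose[OF 1]) (use has_derivative_QD[OF assms(1), of x] in simp)
    moreover have "(\<lambda>t. \<Sum>i\<in>UNIV. hD_inv D (x $ i / \<alpha>) * (t *\<^sub>R m) $ i)
        = (*) (\<Sum>i\<in>UNIV. hD_inv D (x $ i / \<alpha>) * m $ i)"
      by (simp add: fun_eq_iff sum_distrib_left sum_distrib_right mult_ac)
    ultimately show ?thesis by (simp add: has_field_derivative_def)
  qed
  ultimately show ?thesis using DERIV_local_min[of ?f _ 0 1] by auto
qed

end

subsection \<open>Null space property constants\<close>

lemma l1_norm_on_nonneg: "0 \<le> l1_norm_on T x"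
  by (simp add: l1_norm_on_def sum_nonneg)

lemma l1_norm_on_scaleR: "l1_norm_on T (c *\<^sub>R x) = \<bar>c\<bar> * l1_norm_on T x"
  by (simp add: l1_norm_on_def abs_mult sum_distrib_left)

lemma l1_norm_split: "l1_norm x = l1_norm_on T x + l1_norm_on (- T) x"
  unfolding l1_norm_on_def Compl_eq_Diff_UNIV using sum.subset_diff[of T UNIV "\<lambda>i. \<bar>x $ i\<bar>"]
  by simp

lemma continuous_on_l1_norm_on: "continuous_on X (l1_norm_on T)"
  unfolding l1_norm_on_def[abs_def] by (intro continuous_intros)

text \<open>The quotient is constant on rays, so it suffices to maximize it over the unit sphere of
  the kernel, which is compact. This yields finite suprema and, for \<open>nsp_const\<close>, an
  extremal kernel vector.\<close>

lemma homogeneous_quotient_attains_sup: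
  fixes A :: "real ^ 'd ^ 'n" and f g :: "real ^ 'd \<Rightarrow> real"
  assumes ker: "nonzero_kernel A \<noteq> {}"
    and cont: "continuous_on UNIV f" "continuous_on UNIV g"
    and hom: "\<And>c n. c > 0 \<Longrightarrow> f (c *\<^sub>R n) = c * f n" "\<And>c n. c > 0 \<Longrightarrow> g (c *\<^sub>R n) = c * g n"
    and g: "\<And>n. n \<in> nonzero_kernel A \<Longrightarrow> g n \<noteq> 0"
  obtains m where "m \<in> nonzero_kernel A" "\<And>n. n \<in> nonzero_kernel A \<Longrightarrow> f n / g n \<le> f m / g m"
proof -
  define K where "K = sphere 0 1 \<inter> {n. A *v n = 0}"
  have normalize: "(1 / norm n) *\<^sub>R n \<in> K" if "n \<in> nonzero_kernel A" for n
    using that by (auto simp: K_def nonzero_kernel_def matrix_vector_mult_scaleR)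
  have K: "n \<in> nonzero_kernel A" if "n \<in> K" for n
    using that by (auto simp: K_def nonzero_kernel_def)
  have "closed {n. A *v n = 0}"
    by (intro closed_Collect_eq continuous_intros)
  then have "compact K" by (auto simp: K_def intro: compact_Int_closed)
  moreover have "K \<noteq> {}" using ker normalize by blast
  moreover have "continuous_on K (\<lambda>n. f n / g n)"
    using cont g K by (intro continuous_on_divide) (auto intro: continuous_on_subset)
  ultimately obtain m where m: "m \<in> K" "\<And>n. n \<in> K \<Longrightarrow> f n / g n \<le> f m / g m"
    using continuous_attains_sup[of K "\<lambda>n. f n / g n"] by auto
  show thesis
  proof
    show "m \<in> nonzero_kernel A" using m K by simp
    fix n assume n: "n \<in> nonzero_kernel A"
    then have "n \<noteq> 0" by (simp add: nonzero_kernel_def)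
    then show "f n / g n \<le> f m / g m"
      using m(2)[OF normalize[OF n]] hom[of "1 / norm n" n] by simp
  qed
qed

locale unique_l1_minimizer =
  fixes A :: "real ^ 'd ^ 'n" and y :: "real ^ 'n" and g :: "real ^ 'd"
  assumes kernel_nontrivial: "nonzero_kernel A \<noteq> {}"
    and minimizer: "is_arg_min l1_norm (\<lambda>x. A *v x = y) g"
    and unique: "is_arg_min l1_norm (\<lambda>x. A *v x = y) x \<Longrightarrow> x = g"
begin

abbreviation "S \<equiv> supp g"
abbreviation "\<rho> \<equiv> nsp_const A g"
abbreviation "\<rho>m \<equiv> nsp_const_minus A g"
abbreviation "\<rho>t \<equiv> nsp_const_tilde A g"

lemma g_feasible: "A *v g = y"
  using minimizer by (simp add: is_arg_min_def)

lemma l1_norm_less: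
  assumes "n \<in> nonzero_kernel A"
  shows "l1_norm g < l1_norm (g + n)"
proof (rule ccontr)
  assume *: "\<not> l1_norm g < l1_norm (g + n)"
  have "A *v (g + n) = y"
    using assms g_feasible by (simp add: nonzero_kernel_def matrix_vector_right_distrib)
  then have "is_arg_min l1_norm (\<lambda>x. A *v x = y) (g + n)"
    using minimizer * by (auto simp: is_arg_min_def not_less)
  then show False using unique assms by (fastforce simp: nonzero_kernel_def)
qed

lemma scaleR_nonzero_kernel:
  "n \<in> nonzero_kernel A \<Longrightarrow> c \<noteq> 0 \<Longrightarrow> c *\<^sub>R n \<in> nonzero_kernel A"
  by (simp add: nonzero_kernel_def matrix_vector_mult_scaleR)

lemma uminus_nonzero_kernel: "n \<in> nonzero_kernel A \<Longrightarrow> - n \<in> nonzero_kernel A"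
  using scaleR_nonzero_kernel[of n "- 1"] by simp

text \<open>For small \<open>t > 0\<close> the vector \<open>g + t n\<close> flips no sign of
  \<open>g\<close> on the support, so there the norm changes linearly in \<open>t\<close>, while off
  the support it grows by \<open>t\<close> times the norm of \<open>n\<close>. Strict minimality of
  \<open>g\<close> makes the total change positive.\<close>

lemma nsp_strict:
  assumes n: "n \<in> nonzero_kernel A"
  shows "- (\<Sum>i\<in>S. sgn (g $ i) * n $ i) < l1_norm_on (- S) n"
proof -
  \<comment> \<open>Small enough for \<open>t \<bar>n i\<bar> \<le> \<bar>g i\<bar>\<close> on the
    support. The summand \<open>1\<close> in the denominator covers \<open>n i = 0\<close>, and
    \<open>insert 1\<close> covers an empty support.\<close>
  define t where "t = Min (insert 1 ((\<lambda>i. \<bar>g $ i\<bar> / (1 + \<bar>n $ i\<bar>)) ` S))"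
  have t: "t > 0" by (auto simp: t_def supp_def intro!: divide_pos_pos)
  have t_le: "t * \<bar>n $ i\<bar> \<le> \<bar>g $ i\<bar>" if "i \<in> S" for i
  proof -
    have "t \<le> \<bar>g $ i\<bar> / (1 + \<bar>n $ i\<bar>)" using that by (auto simp: t_def intro!: Min_le)
    then have "t * (1 + \<bar>n $ i\<bar>) \<le> \<bar>g $ i\<bar>" by (simp add: field_simps add_pos_nonneg)
    then show ?thesis using t by (simp add: algebra_simps)
  qed
  have "\<bar>g $ i + t * n $ i\<bar> = \<bar>g $ i\<bar> + t * (sgn (g $ i) * n $ i)" if "i \<in> S" for i
  proof -
    have "\<bar>t * n $ i\<bar> \<le> \<bar>g $ i\<bar>" using t_le[OF that] t by (simp add: abs_mult)
    then show ?thesis by (cases "g $ i > 0") (auto simp: sgn_if)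
  qed
  then have "l1_norm_on S (g + t *\<^sub>R n) = l1_norm_on S g + t * (\<Sum>i\<in>S. sgn (g $ i) * n $ i)"
    by (simp add: l1_norm_on_def sum.distrib sum_distrib_left)
  moreover have "l1_norm_on (- S) (g + t *\<^sub>R n) = t * l1_norm_on (- S) n"
    using t by (simp add: l1_norm_on_def supp_def abs_mult sum_distrib_left)
  moreover have "l1_norm_on (- S) g = 0"
    by (simp add: l1_norm_on_def supp_def)
  ultimately have "l1_norm_on S g
      < l1_norm_on S g + t * (\<Sum>i\<in>S. sgn (g $ i) * n $ i) + t * l1_norm_on (- S) n"
    using l1_norm_less[OF scaleR_nonzero_kernel[OF n, of t]] t
      l1_norm_split[of g S] l1_norm_split[of "g + t *\<^sub>R n" S] by simp
  then have "0 < t * ((\<Sum>i\<in>S. sgn (g $ i) * n $ i) + l1_norm_on (- S) n)"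
    by (simp add: distrib_left)
  then show ?thesis using t by (simp add: zero_less_mult_iff)
qed

text \<open>Adding the strict inequalities for \<open>n\<close> and \<open>- n\<close> cancels the
  signed sums. All denominators of the null space constants are therefore positive.\<close>

lemma l1_norm_Compl_pos:
  assumes n: "n \<in> nonzero_kernel A"
  shows "0 < l1_norm_on (- S) n"
  using nsp_strict[OF n] nsp_strict[OF uminus_nonzero_kernel[OF n]]
  by (simp add: sum_negf l1_norm_on_def)

text \<open>Because the supremum is a maximum, the strict inequality of \<open>nsp_strict\<close>
  survives and gives \<open>\<rho> < 1\<close>. The maximizer is the test vector of the lower
  bound.\<close>

lemma
  shows nsp_const_less_1: "\<rho> < 1"
    and nsp_const_le: "n \<in> nonzero_kernel A \<Longrightarrow>
      - (\<Sum>i\<in>S. sgn (g $ i) * n $ i) \<le> \<rho> * l1_norm_on (- S) n"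
    and nsp_const_attained: "\<exists>m \<in> nonzero_kernel A.
      - (\<Sum>i\<in>S. sgn (g $ i) * m $ i) = \<rho> * l1_norm_on (- S) m"
proof -
  let ?f = "\<lambda>n. - (\<Sum>i\<in>S. sgn (g $ i) * n $ i)"
  obtain m where m: "m \<in> nonzero_kernel A"
    and max: "\<And>n. n \<in> nonzero_kernel A \<Longrightarrow>
      ?f n / l1_norm_on (- S) n \<le> ?f m / l1_norm_on (- S) m"
  proof (rule homogeneous_quotient_attains_sup[OF kernel_nontrivial])
    show "continuous_on UNIV ?f" by (intro continuous_intros)
    show "?f (c *\<^sub>R n) = c * ?f n" for c n by (simp add: sum_distrib_left algebra_simps)
    show "n \<in> nonzero_kernel A \<Longrightarrow> l1_norm_on (- S) n \<noteq> 0" for n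
      using l1_norm_Compl_pos by fastforce
  qed (auto simp: continuous_on_l1_norm_on l1_norm_on_scaleR)
  have eq: "\<rho> = ?f m / l1_norm_on (- S) m"
    unfolding nsp_const_def using m max by (intro cSup_eq_maximum) auto
  show "\<rho> < 1"
    unfolding eq using nsp_strict[OF m] l1_norm_Compl_pos[OF m]
    by (simp only: pos_divide_less_eq mult_1)
  show "?f n \<le> \<rho> * l1_norm_on (- S) n" if "n \<in> nonzero_kernel A"
    using max[OF that] l1_norm_Compl_pos[OF that] unfolding eq[symmetric]
    by (simp only: pos_divide_le_eq)
  show "\<exists>m \<in> nonzero_kernel A. ?f m = \<rho> * l1_norm_on (- S) m"
    using eq l1_norm_Compl_pos[OF m] m by (intro bexI[of _ m]) auto
qed

lemma nsp_const_nonneg: "0 \<le> \<rho>"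
proof -
  obtain n where n: "n \<in> nonzero_kernel A" using kernel_nontrivial by auto
  then have "0 \<le> \<rho> * l1_norm_on (- S) n"
    using nsp_const_le[OF n] nsp_const_le[OF uminus_nonzero_kernel[OF n]]
    by (simp add: sum_negf l1_norm_on_def)
  then show ?thesis using l1_norm_Compl_pos[OF n] by (simp add: zero_le_mult_iff)
qed

lemma bdd_above_nsp_const_tilde:
  "bdd_above ((\<lambda>n. l1_norm_on S n / l1_norm_on (- S) n) ` nonzero_kernel A)"
proof -
  obtain m where "\<And>n. n \<in> nonzero_kernel A \<Longrightarrow>
      l1_norm_on S n / l1_norm_on (- S) n \<le> l1_norm_on S m / l1_norm_on (- S) m"
    by (rule homogeneous_quotient_attains_sup[OF kernel_nontrivial,
          of "l1_norm_on S" "l1_norm_on (- S)"])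
      (use l1_norm_Compl_pos in \<open>force simp: continuous_on_l1_norm_on l1_norm_on_scaleR\<close>)+
  then show ?thesis by (auto intro!: bdd_aboveI2)
qed

lemma nsp_const_tilde_le:
  assumes n: "n \<in> nonzero_kernel A"
  shows "l1_norm_on S n \<le> \<rho>t * l1_norm_on (- S) n"
proof -
  have "l1_norm_on S n / l1_norm_on (- S) n \<le> \<rho>t"
    unfolding nsp_const_tilde_def by (rule cSUP_upper[OF n bdd_above_nsp_const_tilde])
  then show ?thesis using l1_norm_Compl_pos[OF n] by (simp add: pos_divide_le_eq)
qed

text \<open>The numerator is dominated by \<open>l1_norm_on S n\<close>, so the supremum is finite
  because the one defining \<open>\<rho>t\<close> is.\<close>

lemma nsp_const_minus_le:
  assumes n: "n \<in> nonzero_kernel A"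
  shows "(\<Sum>i\<in>{i \<in> S. sgn (g $ i) * n $ i < 0}. \<bar>n $ i\<bar>) \<le> \<rho>m * l1_norm_on (- S) n"
proof -
  let ?f = "\<lambda>n. \<Sum>i\<in>{i \<in> S. sgn (g $ i) * n $ i < 0}. \<bar>n $ i\<bar>"
  have le: "?f n / l1_norm_on (- S) n \<le> l1_norm_on S n / l1_norm_on (- S) n" for n
    by (intro divide_right_mono l1_norm_on_nonneg)
      (auto simp: l1_norm_on_def intro!: sum_mono2)
  have "bdd_above ((\<lambda>n. ?f n / l1_norm_on (- S) n) ` nonzero_kernel A)"
    by (rule bdd_above.I2[of _ _ \<rho>t], rule order_trans[OF le])
      (use bdd_above_nsp_const_tilde in \<open>auto simp: nsp_const_tilde_def intro: cSUP_upper\<close>)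
  from cSUP_upper[OF n this] have "?f n / l1_norm_on (- S) n \<le> \<rho>m"
    by (simp add: nsp_const_minus_def)
  then show ?thesis using l1_norm_Compl_pos[OF n] by (simp add: pos_divide_le_eq)
qed

lemma nsp_const_tilde_nonneg: "0 \<le> \<rho>t"
  and nsp_const_minus_nonneg: "0 \<le> \<rho>m"
proof -
  obtain n where n: "n \<in> nonzero_kernel A" using kernel_nontrivial by auto
  note pos = l1_norm_Compl_pos[OF n]
  show "0 \<le> \<rho>t"
    using order_trans[OF l1_norm_on_nonneg nsp_const_tilde_le[OF n]] pos
    by (simp add: zero_le_mult_iff)
  have "0 \<le> (\<Sum>i\<in>{i \<in> S. sgn (g $ i) * n $ i < 0}. \<bar>n $ i\<bar>)" by (simp add: sum_nonneg)
  from order_trans[OF this nsp_const_minus_le[OF n]] show "0 \<le> \<rho>m"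
    using pos by (simp add: zero_le_mult_iff)
qed

lemma Compl_supp_nonempty: "- S \<noteq> {}"
proof
  assume "- S = {}"
  then have "l1_norm_on (- S) n = 0" for n by (simp add: l1_norm_on_def)
  then show False using kernel_nontrivial l1_norm_Compl_pos by fastforce
qed

end

subsection \<open>Estimates for the minimizer\<close>

text \<open>Turns the thresholds of the theorem into products; for \<open>b = 0\<close> the
  threshold is infinite and the product form holds trivially.\<close>

lemma mult_powr_le_of_le_ratio_powr:
  assumes "ereal s \<le> ratio_powr a b (1 / \<gamma>)" "0 \<le> s" "0 < \<gamma>" "0 \<le> a" "0 \<le> b"
  shows "b * s powr \<gamma> \<le> a"
proof (cases "b = 0")
  case False
  then have "s \<le> (a / b) powr (1 / \<gamma>)" using assms by (simp add: ratio_powr_def)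
  then have "s powr \<gamma> \<le> ((a / b) powr (1 / \<gamma>)) powr \<gamma>" using assms by (intro powr_mono2) auto
  also have "\<dots> = a / b" using assms False by (simp add: powr_powr)
  finally show ?thesis using assms False by (simp add: field_simps)
qed (use assms in auto)

section \<open>Scalar estimates: Jensen's inequality and perturbation of \<open>hD\<close>\<close>

context
  fixes D :: nat
  assumes D: "D \<ge> 3"
begin

text \<open>Jensen's inequality for the convex function \<open>t * h\<inverse> t\<close>: summing
  its tangent inequalities at \<open>h c\<close> leaves on the right
  \<open>\<Sum> t (h\<inverse> t - c)\<close>, which is at most \<open>0\<close> by
  assumption.\<close>

lemma sum_le_card_mult_hD:
  assumes "finite T" and t: "\<And>i. i \<in> T \<Longrightarrow> 0 \<le> t i" and c: "0 \<le> c" "c < 1"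
    and le: "(\<Sum>i\<in>T. hD_inv D (t i) * t i) \<le> c * (\<Sum>i\<in>T. t i)"
  shows "(\<Sum>i\<in>T. t i) \<le> real (card T) * hD D c"
proof (cases "c = 0")
  \<comment> \<open>The tangent inequality needs \<open>c > 0\<close>. For \<open>c = 0\<close>
    nonnegative terms sum to at most \<open>0\<close>, so every \<open>t i\<close> vanishes.\<close>
  case True
  have nonneg: "0 \<le> hD_inv D (t i) * t i" if "i \<in> T" for i
    using t[OF that] hD_inv_nonneg[OF D] by simp
  then have "(\<Sum>i\<in>T. hD_inv D (t i) * t i) = 0"
    using le True by (intro antisym sum_nonneg) auto
  then have *: "hD_inv D (t i) * t i = 0" if "i \<in> T" for i
    using that assms(1) nonneg sum_nonneg_eq_0_iff[of T "\<lambda>i. hD_inv D (t i) * t i"] by blast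
  have "t i = 0" if "i \<in> T" for i
    using *[OF that] hD_hD_inv[OF D, of "t i"] by (auto simp: hD_eq_hpow)
  then show ?thesis using True by (simp add: hD_eq_hpow)
next
  case False
  have "real D / (real D - 2) \<ge> 1" using D by simp
  from hpow_tangent[OF this, of c] obtain l where l: "l > 0"
    "\<And>z. 0 \<le> z \<Longrightarrow> z < 1 \<Longrightarrow> l * (hD D z - hD D c) \<le> hD D z * (z - c)"
    using c False by (auto simp: hD_eq_hpow)
  have "l * (t i - hD D c) \<le> t i * (hD_inv D (t i) - c)" if "i \<in> T" for i
    using l(2)[of "hD_inv D (t i)"] hD_inv_bounds[OF D, of "t i"] hD_inv_nonneg[OF D t[OF that]] D
    by simp
  then have "(\<Sum>i\<in>T. l * (t i - hD D c)) \<le> (\<Sum>i\<in>T. t i * (hD_inv D (t i) - c))"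
    by (rule sum_mono)
  also have "\<dots> \<le> 0"
    using le by (simp add: algebra_simps sum_subtractf sum_distrib_left)
  finally have "l * ((\<Sum>i\<in>T. t i) - real (card T) * hD D c) \<le> 0"
    by (simp add: sum_subtractf sum_distrib_left algebra_simps)
  then show ?thesis using l(1) by (simp add: mult_le_0_iff)
qed

lemma hD_sub_le:
  assumes \<gamma>: "\<gamma> = (real D - 2) / real D" and "0 \<le> \<eta>" "\<eta> \<le> r" "r < 1"
  shows "hD D r - 2 * \<eta> / (\<gamma> * (1 - r) powr (1 / \<gamma> + 1)) \<le> hD D (r - \<eta>)"
proof -
  have p: "real D / (real D - 2) = 1 / \<gamma>" "0 < \<gamma>" using D by (auto simp: \<gamma>)
  have "hD D r - hD D (r - \<eta>) \<le> 2 * (1 / \<gamma>) * (1 - r) powr (- (1 / \<gamma>) - 1) * \<eta>"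
    using hpow_lipschitz[of "1 / \<gamma>" "r - \<eta>" r] assms(2-) p by (simp add: hD_eq_hpow)
  also have "(1 - r) powr (- (1 / \<gamma>) - 1) = inverse ((1 - r) powr (1 / \<gamma> + 1))"
    by (simp flip: powr_minus)
  finally show ?thesis by (simp add: field_simps)
qed

text \<open>\<open>hD_sub_le\<close> at \<open>r + \<eta>\<close> has
  \<open>1 - (r + \<eta>)\<close> in the denominator. The bound on \<open>\<eta>\<close> keeps this
  at least \<open>(1 - r) (1 - \<gamma> / 4)\<close>, which costs a factor of at most
  \<open>2\<close> and turns the constant \<open>2\<close> into \<open>4\<close>.\<close>

lemma hD_add_le:
  assumes \<gamma>: "\<gamma> = (real D - 2) / real D" and \<eta>: "0 \<le> \<eta>" "\<eta> \<le> (1 - r) * \<gamma> / 4"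
    and r: "0 \<le> r" "r < 1"
  shows "hD D (r + \<eta>) \<le> hD D r + 4 * \<eta> / (\<gamma> * (1 - r) powr (1 / \<gamma> + 1))"
proof -
  have p: "0 < \<gamma>" "\<gamma> < 1" using D by (auto simp: \<gamma>)
  \<comment> \<open>Bernoulli's inequality \<open>1 - s v \<le> (1 - v) powr s\<close> with
    \<open>s = 1 / \<gamma> + 1\<close> and \<open>v = \<gamma> / 4\<close>, proved by the mean
    value theorem; here \<open>s v = (1 + \<gamma>) / 4 \<le> 1 / 2\<close>.\<close>
  have "1 - (1 / \<gamma> + 1) * (\<gamma> / 4) \<le> (1 - \<gamma> / 4) powr (1 / \<gamma> + 1)"
  proof -
    have lt: "1 - \<gamma> / 4 < 1" using p by simp
    have der: "((\<lambda>z. z powr (1 / \<gamma> + 1)) has_real_derivative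
        (1 / \<gamma> + 1) * z powr (1 / \<gamma> + 1 - 1)) (at z)"
      if "1 - \<gamma> / 4 \<le> z" "z \<le> 1" for z
      using that p by (intro has_real_derivative_powr) auto
    obtain z where z: "1 - \<gamma> / 4 < z" "z < 1"
      "1 powr (1 / \<gamma> + 1) - (1 - \<gamma> / 4) powr (1 / \<gamma> + 1)
        = (1 - (1 - \<gamma> / 4)) * ((1 / \<gamma> + 1) * z powr (1 / \<gamma> + 1 - 1))"
      using MVT2[OF lt der] by blast
    have "z powr (1 / \<gamma> + 1 - 1) \<le> 1" using z p by (intro powr_le1) auto
    then have "\<gamma> / 4 * ((1 / \<gamma> + 1) * z powr (1 / \<gamma> + 1 - 1)) \<le> \<gamma> / 4 * ((1 / \<gamma> + 1) * 1)"
      using p by (intro mult_left_mono) auto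
    moreover have "1 - (1 - \<gamma> / 4) powr (1 / \<gamma> + 1)
        = \<gamma> / 4 * ((1 / \<gamma> + 1) * z powr (1 / \<gamma> + 1 - 1))"
      using z(3) by simp
    moreover have "\<gamma> / 4 * ((1 / \<gamma> + 1) * 1) = (1 / \<gamma> + 1) * (\<gamma> / 4)" by simp
    ultimately show ?thesis by linarith
  qed
  moreover have "(1 / \<gamma> + 1) * (\<gamma> / 4) = (1 + \<gamma>) / 4" using p by (simp add: field_simps)
  ultimately have "1 - (1 + \<gamma>) / 4 \<le> (1 - \<gamma> / 4) powr (1 / \<gamma> + 1)" by (simp only:)
  moreover have "1 / 2 \<le> 1 - (1 + \<gamma>) / 4" using p by simp
  ultimately have B: "1 / 2 \<le> (1 - \<gamma> / 4) powr (1 / \<gamma> + 1)" by (rule order_trans[rotated])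
  have "(1 - r) * (\<gamma> / 4) < (1 - r) * 1" using p(2) r(2) by (intro mult_strict_left_mono) auto
  then have "(1 - r) * \<gamma> / 4 < 1 - r" by simp
  from le_less_trans[OF \<eta>(2) this] have r\<eta>: "r + \<eta> < 1" by simp
  have "(1 - r) powr (1 / \<gamma> + 1) / 2 \<le> (1 - r) powr (1 / \<gamma> + 1) * (1 - \<gamma> / 4) powr (1 / \<gamma> + 1)"
    using mult_left_mono[OF B, of "(1 - r) powr (1 / \<gamma> + 1)"] by simp
  also have "\<dots> = ((1 - r) * (1 - \<gamma> / 4)) powr (1 / \<gamma> + 1)"
    using r p by (simp add: powr_mult)
  also have "\<dots> \<le> (1 - (r + \<eta>)) powr (1 / \<gamma> + 1)"
  proof (rule powr_mono2)
    have "(1 - r) * (1 - \<gamma> / 4) = 1 - r - (1 - r) * \<gamma> / 4" by (simp add: algebra_simps)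
    also have "\<dots> \<le> 1 - r - \<eta>" using \<eta>(2) by (rule diff_left_mono)
    finally show "(1 - r) * (1 - \<gamma> / 4) \<le> 1 - (r + \<eta>)" by simp
    show "0 \<le> (1 - r) * (1 - \<gamma> / 4)" using r(2) p(2) by (intro mult_nonneg_nonneg) simp_all
    show "0 \<le> 1 / \<gamma> + 1" using p(1) by simp
  qed
  finally have C: "(1 - r) powr (1 / \<gamma> + 1) / 2 \<le> (1 - (r + \<eta>)) powr (1 / \<gamma> + 1)" .
  have "hD D (r + \<eta>) \<le> hD D r + 2 * \<eta> / (\<gamma> * (1 - (r + \<eta>)) powr (1 / \<gamma> + 1))"
    using hD_sub_le[OF \<gamma>, of \<eta> "r + \<eta>"] \<eta>(1) r r\<eta> by simp
  also have "2 * \<eta> / (\<gamma> * (1 - (r + \<eta>)) powr (1 / \<gamma> + 1))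
      \<le> 2 * \<eta> / (\<gamma> * ((1 - r) powr (1 / \<gamma> + 1) / 2))"
    using C p \<eta>(1) r r\<eta> by (intro divide_left_mono mult_left_mono mult_pos_pos) auto
  finally show ?thesis by (simp add: field_simps)
qed

end

section \<open>Comparison of the Bregman minimizer with the sparse solution\<close>

locale bregman_l1 = unique_l1_minimizer A y g
  for A :: "real ^ 'd ^ 'n" and y :: "real ^ 'n" and g :: "real ^ 'd" +
  fixes D :: nat and \<alpha> :: real and x :: "real ^ 'd"
  assumes y_nonzero: "y \<noteq> 0"
    and D: "D \<ge> 3"
    and \<alpha>: "\<alpha> > 0"
    and x_min: "is_arg_min (\<lambda>x. bregman (QD D \<alpha>) x 0) (\<lambda>x. A *v x = y) x"
begin

definition "gmin = Min ((\<lambda>i. \<bar>g $ i\<bar>) ` S)"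
definition "\<gamma> = (real D - 2) / real D"
text \<open>Bounds the gap between \<open>h\<inverse>\<close> and \<open>1\<close> at arguments from
  \<open>gmin / \<alpha>\<close> on; the error terms of both bounds are linear in it.\<close>

definition "\<delta> = (\<alpha> / gmin) powr \<gamma>"

lemma gamma_bounds: "1 / 3 \<le> \<gamma>" "\<gamma> < 1"
  using D by (auto simp: \<gamma>_def field_simps)

lemma supp_nonempty: "S \<noteq> {}"
proof
  assume "S = {}"
  then have "g = 0" by (auto simp: supp_def vec_eq_iff)
  then show False using g_feasible y_nonzero by simp
qed

lemma gmin_le: "i \<in> S \<Longrightarrow> gmin \<le> \<bar>g $ i\<bar>"
  by (auto simp: gmin_def)

lemma gmin_pos: "0 < gmin"
  using supp_nonempty by (auto simp: gmin_def supp_def)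

lemma diff_in_kernel: "x - g \<noteq> 0 \<Longrightarrow> x - g \<in> nonzero_kernel A"
  using x_min g_feasible
  by (simp add: nonzero_kernel_def is_arg_min_def matrix_vector_mult_diff_distrib)

lemma stationary:
  assumes "m \<in> nonzero_kernel A"
  shows "(\<Sum>i\<in>- S. hD_inv D (x $ i / \<alpha>) * m $ i) = - (\<Sum>i\<in>S. hD_inv D (x $ i / \<alpha>) * m $ i)"
proof -
  have "(\<Sum>i\<in>UNIV. hD_inv D (x $ i / \<alpha>) * m $ i) = 0"
    using bregman_QD_minimizer_stationary[OF D \<alpha> x_min] assms by (simp add: nonzero_kernel_def)
  then show ?thesis
    using sum.subset_diff[of S UNIV "\<lambda>i. hD_inv D (x $ i / \<alpha>) * m $ i"]
    by (simp add: Compl_eq_Diff_UNIV)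
qed

text \<open>As \<open>h\<inverse>\<close> is odd, the sign of \<open>g i\<close> can be put on both
  factors, and \<open>sgn (g i) * x i = \<bar>g i\<bar> + sgn (g i) * (x - g) i\<close>. This
  reduces the support to the case of positive \<open>g i\<close>.\<close>

lemma hD_inv_sgn:
  assumes "i \<in> S"
  shows "hD_inv D (x $ i / \<alpha>) * v
    = hD_inv D ((\<bar>g $ i\<bar> + sgn (g $ i) * (x - g) $ i) / \<alpha>) * (sgn (g $ i) * v)"
proof (cases "g $ i > 0")
  case False
  then have "\<bar>g $ i\<bar> + sgn (g $ i) * (x - g) $ i = - x $ i" "sgn (g $ i) = - 1"
    using assms by (auto simp: supp_def)
  then show ?thesis using hD_inv_minus[OF D, of "x $ i / \<alpha>"] by simp
qed auto

text \<open>Used with \<open>c = 1\<close> for entries of size at least \<open>gmin\<close>, and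
  with \<open>c = 2\<close> once only half of that size is known.\<close>

lemma one_minus_hD_inv_scaled_le:
  assumes "gmin \<le> c * u" "0 < c"
  shows "1 - hD_inv D (u / \<alpha>) \<le> c powr \<gamma> * \<delta>"
proof -
  have u: "gmin / c \<le> u" "u > 0" using assms gmin_pos
    by (auto simp: field_simps) (metis assms(2) less_le_trans zero_less_mult_pos)
  have "1 - hD_inv D (u / \<alpha>) \<le> (1 / (u / \<alpha>)) powr \<gamma>"
    using one_minus_hD_inv_le[OF D, of "u / \<alpha>"] u \<alpha> by (simp add: \<gamma>_def)
  also have "\<dots> \<le> (c * (\<alpha> / gmin)) powr \<gamma>"
    using u \<alpha> gmin_pos assms gamma_bounds
    by (intro powr_mono2) (auto simp: field_simps)
  also have "\<dots> = c powr \<gamma> * \<delta>"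
    using assms \<alpha> gmin_pos by (subst powr_mult) (auto simp: \<delta>_def)
  finally show ?thesis .
qed

lemma sum_Compl_le:
  assumes n: "x - g \<in> nonzero_kernel A"
  shows "(\<Sum>i\<in>- S. hD_inv D (x $ i / \<alpha>) * (x - g) $ i) \<le> (\<rho> + \<rho>m * \<delta>) * l1_norm_on (- S) (x - g)"
proof -
  let ?n = "x - g"
  define w where "w = hD_inv D (gmin / \<alpha>)"
  define N where "N = {i \<in> S. sgn (g $ i) * ?n $ i < 0}"
  have w: "0 \<le> w" "w \<le> 1" "1 - w \<le> \<delta>"
    using hD_inv_nonneg[OF D] hD_inv_bounds[OF D, of "gmin / \<alpha>"] gmin_pos \<alpha>
      one_minus_hD_inv_scaled_le[of 1 gmin] by (auto simp: w_def)
  \<comment> \<open>The weight \<open>w\<close> separates the two constants. For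
    \<open>v < 0\<close> the right side is \<open>\<bar>v\<bar>\<close> and \<open>z \<le> 1\<close>
    suffices; for \<open>v \<ge> 0\<close> it is \<open>- w v\<close>, and \<open>w \<le> z\<close>
    holds because the entry has moved away from \<open>0\<close>. Summation pairs \<open>w\<close>
    with \<open>\<rho>\<close> and \<open>1 - w \<le> \<delta>\<close> with
    \<open>\<rho>m\<close>.\<close>
  have "- (hD_inv D (x $ i / \<alpha>) * ?n $ i)
      \<le> w * (- (sgn (g $ i) * ?n $ i)) + (1 - w) * (if i \<in> N then \<bar>?n $ i\<bar> else 0)"
    if i: "i \<in> S" for i
  proof -
    define v where "v = sgn (g $ i) * ?n $ i"
    define z where "z = hD_inv D ((\<bar>g $ i\<bar> + v) / \<alpha>)"
    have av: "\<bar>?n $ i\<bar> = \<bar>v\<bar>" using i by (simp add: v_def abs_mult supp_def sgn_if)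
    have N: "i \<in> N \<longleftrightarrow> v < 0" using i by (simp add: N_def v_def)
    have "- (z * v) \<le> w * (- v) + (1 - w) * (if v < 0 then \<bar>v\<bar> else 0)"
    proof (cases "v < 0")
      case True
      have "z \<le> 1" using hD_inv_bounds[OF D, of "(\<bar>g $ i\<bar> + v) / \<alpha>"] by (simp add: z_def)
      then have "z * \<bar>v\<bar> \<le> 1 * \<bar>v\<bar>" by (rule mult_right_mono) simp
      then show ?thesis using True by (simp add: algebra_simps)
    next
      case False
      then have "w \<le> z" unfolding w_def z_def hD_inv_le_iff[OF D]
        using gmin_le[OF i] \<alpha> by (intro divide_right_mono) auto
      then have "w * v \<le> z * v" using False by (intro mult_right_mono) auto
      then show ?thesis using False by simp
    qed
    then show ?thesis
      unfolding hD_inv_sgn[OF i] N av by (simp add: v_def z_def)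
  qed
  then have "(\<Sum>i\<in>S. - (hD_inv D (x $ i / \<alpha>) * ?n $ i))
      \<le> (\<Sum>i\<in>S. w * (- (sgn (g $ i) * ?n $ i)) + (1 - w) * (if i \<in> N then \<bar>?n $ i\<bar> else 0))"
    by (rule sum_mono)
  also have "\<dots> = w * (- (\<Sum>i\<in>S. sgn (g $ i) * ?n $ i))
      + (1 - w) * (\<Sum>i\<in>S. if i \<in> N then \<bar>?n $ i\<bar> else 0)"
    by (simp only: sum.distrib sum_distrib_left sum_negf[symmetric])
  also have "(\<Sum>i\<in>S. if i \<in> N then \<bar>?n $ i\<bar> else 0) = (\<Sum>i\<in>N. \<bar>?n $ i\<bar>)"
    by (rule sum.mono_neutral_cong_right) (auto simp: N_def)
  also have "w * (- (\<Sum>i\<in>S. sgn (g $ i) * ?n $ i)) + (1 - w) * (\<Sum>i\<in>N. \<bar>?n $ i\<bar>)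
      \<le> w * (\<rho> * l1_norm_on (- S) ?n) + (1 - w) * (\<rho>m * l1_norm_on (- S) ?n)"
    using w nsp_const_le[OF n] nsp_const_minus_le[OF n]
    by (intro add_mono mult_left_mono) (auto simp: N_def)
  also have "\<dots> \<le> 1 * (\<rho> * l1_norm_on (- S) ?n) + \<delta> * (\<rho>m * l1_norm_on (- S) ?n)"
    using w nsp_const_nonneg nsp_const_minus_nonneg
    by (intro add_mono mult_right_mono mult_nonneg_nonneg l1_norm_on_nonneg) auto
  finally show ?thesis
    unfolding stationary[OF n] sum_negf[symmetric]
    by (simp only: distrib_right distrib_left mult_1 mult_ac)
qed

lemma upper_bound:
  assumes thr: "4 * \<rho>m * \<delta> \<le> (1 - \<rho>) * \<gamma>"
  shows "l1_norm (x - g) / \<alpha> \<le> real (card (- S)) * (1 + \<rho>t) *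
    (hD D \<rho> + 4 * \<rho>m / (\<gamma> * (1 - \<rho>) powr (1 / \<gamma> + 1)) * \<delta>)"
proof -
  define B where "B = hD D \<rho> + 4 * \<rho>m / (\<gamma> * (1 - \<rho>) powr (1 / \<gamma> + 1)) * \<delta>"
  define c where "c = \<rho> + \<rho>m * \<delta>"
  have \<delta>: "0 \<le> \<delta>" by (simp add: \<delta>_def)
  have "(1 - \<rho>) * \<gamma> < (1 - \<rho>) * 4"
    using gamma_bounds nsp_const_less_1 by (intro mult_strict_left_mono) auto
  \<comment> \<open>The threshold and \<open>\<gamma> < 4\<close> give
    \<open>\<rho>m \<delta> < 1 - \<rho>\<close>, so \<open>c\<close> lies in the domain of
    \<open>hD\<close>.\<close>
  then have c: "0 \<le> c" "c < 1"
    using thr nsp_const_nonneg nsp_const_minus_nonneg \<delta> by (auto simp: c_def)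
  have hc: "hD D c \<le> B"
    unfolding c_def B_def using hD_add_le[OF D \<gamma>_def, of "\<rho>m * \<delta>" \<rho>] thr nsp_const_nonneg
      nsp_const_minus_nonneg \<delta> nsp_const_less_1 by (simp add: algebra_simps)
  have "0 \<le> hD D c" using hD_le_iff[OF D, of 0 c] c by (simp add: hD_eq_hpow)
  show ?thesis
  proof (cases "x - g = 0")
    case True
    then show ?thesis
      using hc \<open>0 \<le> hD D c\<close> nsp_const_tilde_nonneg unfolding B_def[symmetric]
      by (simp add: l1_norm_on_def)
  next
    case False
    then have n: "x - g \<in> nonzero_kernel A" by (rule diff_in_kernel)
    \<comment> \<open>Off the support \<open>x - g\<close> agrees with \<open>x\<close>, and
      \<open>u * h\<inverse> u\<close> is even in \<open>u\<close>.\<close>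
    have eq: "hD_inv D (\<bar>(x - g) $ i\<bar> / \<alpha>) * (\<bar>(x - g) $ i\<bar> / \<alpha>)
        = hD_inv D (x $ i / \<alpha>) * (x - g) $ i / \<alpha>" if "i \<in> - S" for i
      using hD_inv_mult_abs[OF D, of "x $ i / \<alpha>"] that \<alpha> by (simp add: supp_def)
    have "(\<Sum>i\<in>- S. hD_inv D (\<bar>(x - g) $ i\<bar> / \<alpha>) * (\<bar>(x - g) $ i\<bar> / \<alpha>))
        = (\<Sum>i\<in>- S. hD_inv D (x $ i / \<alpha>) * (x - g) $ i) / \<alpha>"
      unfolding sum_divide_distrib by (rule sum.cong[OF refl eq])
    also have "\<dots> \<le> c * l1_norm_on (- S) (x - g) / \<alpha>"
      using sum_Compl_le[OF n] \<alpha> by (intro divide_right_mono) (auto simp: c_def)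
    also have "\<dots> = c * (\<Sum>i\<in>- S. \<bar>(x - g) $ i\<bar> / \<alpha>)"
      by (simp add: l1_norm_on_def flip: sum_divide_distrib)
    finally have "(\<Sum>i\<in>- S. \<bar>(x - g) $ i\<bar> / \<alpha>) \<le> real (card (- S)) * hD D c"
      by (intro sum_le_card_mult_hD[OF D]) (use c \<alpha> in auto)
    then have "l1_norm_on (- S) (x - g) / \<alpha> \<le> real (card (- S)) * B"
      using hc by (simp add: l1_norm_on_def sum_divide_distrib)
        (meson mult_left_mono of_nat_0_le_iff order_trans)
    then have "(1 + \<rho>t) * (l1_norm_on (- S) (x - g) / \<alpha>) \<le> (1 + \<rho>t) * (real (card (- S)) * B)"
      using nsp_const_tilde_nonneg by (intro mult_left_mono) auto
    \<comment> \<open>The factor \<open>1 + \<rho>t\<close> extends the estimate from the complement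
      to all coordinates.\<close>
    moreover have "l1_norm (x - g) \<le> (1 + \<rho>t) * l1_norm_on (- S) (x - g)"
      using nsp_const_tilde_le[OF n] l1_norm_split[of "x - g" S] by (simp add: algebra_simps)
    then have "l1_norm (x - g) / \<alpha> \<le> (1 + \<rho>t) * l1_norm_on (- S) (x - g) / \<alpha>"
      using \<alpha> by (intro divide_right_mono) auto
    ultimately show ?thesis unfolding B_def[symmetric] by (simp add: mult_ac)
  qed
qed

text \<open>Under the first threshold each of the two terms in the bracket of the upper bound is at
  most \<open>1 / P\<close>; the factor \<open>4\<close> in the second threshold then leaves
  \<open>gmin / 2\<close>. Hence on the support \<open>x\<close> keeps the signs of \<open>g\<close>
  and at least half of its size.\<close>

lemma l1_error_le_half:
  assumes thr1: "4 * \<rho>m * \<delta> \<le> (1 - \<rho>) * \<gamma>"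
    and thr2: "\<alpha> / gmin \<le> (1 - \<rho>) powr (1 / \<gamma>) / (4 * (1 + \<rho>t) * real (card (- S)))"
  shows "l1_norm (x - g) \<le> gmin / 2"
proof -
  define K where "K = real (card (- S)) * (1 + \<rho>t)"
  define P where "P = (1 - \<rho>) powr (1 / \<gamma>)"
  have "0 < card (- S)" using Compl_supp_nonempty by (simp only: card_gt_0_iff) simp
  then have K: "K > 0"
    unfolding K_def using nsp_const_tilde_nonneg by (intro mult_pos_pos) simp_all
  have P: "P > 0" using nsp_const_less_1 by (simp add: P_def)
  have p: "real D / (real D - 2) = 1 / \<gamma>" by (simp add: \<gamma>_def)
  have Q: "(1 - \<rho>) powr (1 / \<gamma> + 1) = P * (1 - \<rho>)"
    using nsp_const_less_1 by (simp add: P_def powr_add)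
  have "hD D \<rho> \<le> 1 / P"
    by (simp add: hD_def p P_def powr_minus_divide)
  moreover have "4 * \<rho>m / (\<gamma> * (1 - \<rho>) powr (1 / \<gamma> + 1)) * \<delta> \<le> 1 / P"
  proof -
    have "4 * \<rho>m / (\<gamma> * (P * (1 - \<rho>))) * \<delta> = 4 * \<rho>m * \<delta> / (\<gamma> * (P * (1 - \<rho>)))" by simp
    also have "\<dots> \<le> (1 - \<rho>) * \<gamma> / (\<gamma> * (P * (1 - \<rho>)))"
      using thr1 P gamma_bounds nsp_const_less_1 by (intro divide_right_mono) auto
    also have "\<dots> = 1 / P" using gamma_bounds nsp_const_less_1 by simp
    finally show ?thesis unfolding Q .
  qed
  ultimately have "hD D \<rho> + 4 * \<rho>m / (\<gamma> * (1 - \<rho>) powr (1 / \<gamma> + 1)) * \<delta> \<le> 2 / P" by simp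
  then have "K * (hD D \<rho> + 4 * \<rho>m / (\<gamma> * (1 - \<rho>) powr (1 / \<gamma> + 1)) * \<delta>) \<le> K * (2 / P)"
    using K by (intro mult_left_mono) auto
  then have "l1_norm (x - g) / \<alpha> \<le> K * (2 / P)"
    using upper_bound[OF thr1] by (simp add: K_def)
  then have "l1_norm (x - g) * P \<le> 2 * K * \<alpha>" using \<alpha> P by (simp add: field_simps)
  moreover have "4 * K * \<alpha> \<le> P * gmin"
    using thr2 K gmin_pos unfolding P_def[symmetric] by (simp add: K_def field_simps)
  ultimately have "P * l1_norm (x - g) \<le> P * (gmin / 2)" by (simp add: mult.commute)
  then show ?thesis using P by simp
qed

lemma hD_inv_linf_ge:
  assumes half: "l1_norm (x - g) \<le> gmin / 2"
  shows "\<rho> - 2 powr \<gamma> * \<rho>t * \<delta> \<le> hD_inv D (linf_norm_on (- S) (x - g) / \<alpha>)"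
proof -
  let ?n = "x - g"
  define \<phi> where "\<phi> = hD_inv D (linf_norm_on (- S) ?n / \<alpha>)"
  obtain m where m: "m \<in> nonzero_kernel A"
    and max: "- (\<Sum>i\<in>S. sgn (g $ i) * m $ i) = \<rho> * l1_norm_on (- S) m"
    using nsp_const_attained by auto
  \<comment> \<open>The monotone odd function \<open>h\<inverse>\<close> attains its largest
    absolute value at the largest entry, so \<open>\<phi>\<close> bounds all coefficients off the
    support.\<close>
  have off: "hD_inv D (x $ i / \<alpha>) * m $ i \<le> \<phi> * \<bar>m $ i\<bar>" if i: "i \<in> - S" for i
  proof -
    have "\<bar>x $ i\<bar> \<le> linf_norm_on (- S) ?n"
      unfolding linf_norm_on_def using i by (intro Max_ge) (auto simp: supp_def)
    then have "hD_inv D \<bar>x $ i / \<alpha>\<bar> \<le> \<phi>"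
      using \<alpha> by (simp add: \<phi>_def hD_inv_le_iff[OF D] divide_right_mono)
    then have "\<bar>hD_inv D (x $ i / \<alpha>)\<bar> * \<bar>m $ i\<bar> \<le> \<phi> * \<bar>m $ i\<bar>"
      unfolding abs_hD_inv[OF D] by (rule mult_right_mono) simp
    then show ?thesis by (metis abs_ge_self abs_mult order_trans)
  qed
  have on: "- (sgn (g $ i) * m $ i) \<le> - (hD_inv D (x $ i / \<alpha>) * m $ i) + 2 powr \<gamma> * \<delta> * \<bar>m $ i\<bar>"
    if i: "i \<in> S" for i
  proof -
    define u where "u = \<bar>g $ i\<bar> + sgn (g $ i) * ?n $ i"
    have "\<bar>?n $ i\<bar> \<le> l1_norm ?n"
      unfolding l1_norm_on_def by (rule member_le_sum) auto
    moreover have "\<bar>sgn (g $ i) * ?n $ i\<bar> = \<bar>?n $ i\<bar>"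
      using i by (simp add: abs_mult supp_def sgn_if)
    \<comment> \<open>The signed entry \<open>u\<close> of \<open>x\<close> is at least
      \<open>\<bar>g i\<bar> - gmin / 2\<close>, hence at least \<open>gmin / 2\<close>; this is the
      source of \<open>2 powr \<gamma>\<close>.\<close>
    ultimately have "gmin \<le> 2 * u" using half gmin_le[OF i] by (simp add: u_def)
    then have le: "1 - hD_inv D (u / \<alpha>) \<le> 2 powr \<gamma> * \<delta>" by (rule one_minus_hD_inv_scaled_le) simp
    have "- ((1 - hD_inv D (u / \<alpha>)) * (sgn (g $ i) * m $ i))
        \<le> \<bar>(1 - hD_inv D (u / \<alpha>)) * (sgn (g $ i) * m $ i)\<bar>"
      by simp
    also have "\<dots> = (1 - hD_inv D (u / \<alpha>)) * \<bar>m $ i\<bar>"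
      using hD_inv_bounds[OF D, of "u / \<alpha>"] i by (auto simp: abs_mult supp_def sgn_if)
    also have "\<dots> \<le> 2 powr \<gamma> * \<delta> * \<bar>m $ i\<bar>" using le by (rule mult_right_mono) simp
    finally show ?thesis
      unfolding hD_inv_sgn[OF i] u_def[symmetric] by (simp add: algebra_simps)
  qed
  have "\<rho> * l1_norm_on (- S) m = (\<Sum>i\<in>S. - (sgn (g $ i) * m $ i))"
    by (simp add: max[symmetric] sum_negf)
  also have "\<dots> \<le> (\<Sum>i\<in>S. - (hD_inv D (x $ i / \<alpha>) * m $ i) + 2 powr \<gamma> * \<delta> * \<bar>m $ i\<bar>)"
    by (rule sum_mono[OF on])
  also have "\<dots> = (\<Sum>i\<in>- S. hD_inv D (x $ i / \<alpha>) * m $ i) + 2 powr \<gamma> * \<delta> * l1_norm_on S m"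
    by (simp only: stationary[OF m] sum.distrib sum_negf sum_distrib_left l1_norm_on_def)
  also have "\<dots> \<le> (\<Sum>i\<in>- S. \<phi> * \<bar>m $ i\<bar>) + 2 powr \<gamma> * \<delta> * (\<rho>t * l1_norm_on (- S) m)"
    using nsp_const_tilde_le[OF m]
    by (intro add_mono sum_mono off mult_left_mono) (auto simp: \<delta>_def)
  also have "\<dots> = (\<phi> + 2 powr \<gamma> * \<rho>t * \<delta>) * l1_norm_on (- S) m"
    by (simp add: l1_norm_on_def sum_distrib_left[symmetric] algebra_simps)
  finally have "\<rho> \<le> \<phi> + 2 powr \<gamma> * \<rho>t * \<delta>" using l1_norm_Compl_pos[OF m] by simp
  then show ?thesis by (simp add: \<phi>_def)
qed

lemma lower_bound:
  assumes thr1: "4 * \<rho>m * \<delta> \<le> (1 - \<rho>) * \<gamma>"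
    and thr2: "\<alpha> / gmin \<le> (1 - \<rho>) powr (1 / \<gamma>) / (4 * (1 + \<rho>t) * real (card (- S)))"
    and thr3: "(\<rho> + 2 powr (2 + \<gamma>) * \<rho>t * \<gamma> * \<kappa>) * \<delta> \<le> \<rho>"
    and \<kappa>: "1 \<le> \<kappa>"
  shows "hD D \<rho> - 2 * (\<rho> + 2 powr (2 + \<gamma>) * \<rho>t * \<gamma> * \<kappa>) / (\<gamma> * (1 - \<rho>) powr (1 / \<gamma> + 1)) * \<delta>
    \<le> linf_norm_on (- S) (x - g) / \<alpha>"
proof -
  define C where "C = \<rho> + 2 powr (2 + \<gamma>) * \<rho>t * \<gamma> * \<kappa>"
  define \<eta> where "\<eta> = 2 powr \<gamma> * \<rho>t * \<delta>"
  let ?M = "linf_norm_on (- S) (x - g) / \<alpha>"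
  have \<delta>: "0 \<le> \<delta>" by (simp add: \<delta>_def)
  have \<eta>: "0 \<le> \<eta>" using nsp_const_tilde_nonneg \<delta> by (simp add: \<eta>_def)
  \<comment> \<open>Since \<open>\<gamma> \<ge> 1 / 3\<close> and \<open>\<kappa> \<ge> 1\<close>,
    the factor \<open>4 \<gamma> \<kappa>\<close> by which the stated constant exceeds
    \<open>2 powr \<gamma> * \<rho>t\<close> is at least \<open>1\<close>. Thus
    \<open>\<eta> \<le> C \<delta>\<close>, and the third threshold gives
    \<open>\<eta> \<le> \<rho>\<close>.\<close>
  have "1 / 4 * 1 \<le> \<gamma> * \<kappa>" using gamma_bounds \<kappa> by (intro mult_mono) auto
  then have "2 powr \<gamma> * \<rho>t * 1 \<le> 2 powr \<gamma> * \<rho>t * (4 * (\<gamma> * \<kappa>))"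
    using nsp_const_tilde_nonneg by (intro mult_left_mono) auto
  then have "2 powr \<gamma> * \<rho>t \<le> C"
    using nsp_const_nonneg by (simp add: C_def powr_add mult_ac)
  then have \<eta>C: "\<eta> \<le> C * \<delta>" unfolding \<eta>_def using \<delta> by (rule mult_right_mono)
  then have \<eta>\<rho>: "\<eta> \<le> \<rho>" using thr3 by (simp add: C_def)
  have "\<rho> - \<eta> \<le> hD_inv D ?M"
    using hD_inv_linf_ge[OF l1_error_le_half[OF thr1 thr2]] by (simp add: \<eta>_def)
  then have "hD D (\<rho> - \<eta>) \<le> hD D (hD_inv D ?M)"
    using hD_inv_bounds[OF D, of ?M] \<eta> \<eta>\<rho> nsp_const_less_1 by (subst hD_le_iff[OF D]) auto
  then have "hD D (\<rho> - \<eta>) \<le> ?M" by (simp add: D)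
  moreover have "hD D \<rho> - 2 * \<eta> / (\<gamma> * (1 - \<rho>) powr (1 / \<gamma> + 1)) \<le> hD D (\<rho> - \<eta>)"
    by (rule hD_sub_le[OF D \<gamma>_def \<eta> \<eta>\<rho> nsp_const_less_1])
  moreover have "2 * \<eta> / (\<gamma> * (1 - \<rho>) powr (1 / \<gamma> + 1))
      \<le> 2 * (C * \<delta>) / (\<gamma> * (1 - \<rho>) powr (1 / \<gamma> + 1))"
    using \<eta>C gamma_bounds by (intro divide_right_mono) auto
  ultimately show ?thesis unfolding C_def[symmetric] by simp
qed

end

theorem theorem2p8:
  fixes A :: "real ^ 'd ^ 'n" and y :: "real ^ 'n" and g xinf :: "real ^ 'd"
    and D :: nat and \<alpha> :: real
  defines "S \<equiv> supp g"
    and "\<rho> \<equiv> nsp_const A g"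
    and "\<rho>m \<equiv> nsp_const_minus A g"
    and "\<rho>t \<equiv> nsp_const_tilde A g"
    and "gmin \<equiv> Min ((\<lambda>i. \<bar>g $ i\<bar>) ` supp g)"
    and "\<kappa> \<equiv> Max ((\<lambda>i. \<bar>g $ i\<bar>) ` supp g) / Min ((\<lambda>i. \<bar>g $ i\<bar>) ` supp g)"
    and "\<gamma> \<equiv> (real D - 2) / real D"
  assumes feasible: "\<exists>x. A *v x = y"
    and y_nonzero: "y \<noteq> 0"
    and kernel_nontrivial: "{n. A *v n = 0} \<noteq> {0}"
    and g_minimizer: "is_arg_min l1_norm (\<lambda>x. A *v x = y) g"
    and g_unique: "\<And>x. is_arg_min l1_norm (\<lambda>x. A *v x = y) x \<Longrightarrow> x = g"
    and D_ge_3: "D \<ge> 3"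
    and \<alpha>_pos: "\<alpha> > 0"
    and xinf_minimizer: "is_arg_min (\<lambda>x. bregman (QD D \<alpha>) x 0) (\<lambda>x. A *v x = y) xinf"
  shows
    "(ereal (\<alpha> / gmin) < ratio_powr ((1 - \<rho>) * \<gamma>) (4 * \<rho>m) (1 / \<gamma>) \<longrightarrow>
        l1_norm (xinf - g) / \<alpha>
          \<le> real (card (- S)) * (1 + \<rho>t) *
             (hD D \<rho> + 4 * \<rho>m / (\<gamma> * (1 - \<rho>) powr (1 / \<gamma> + 1)) * (\<alpha> / gmin) powr \<gamma>))
     \<and>
     (ereal (\<alpha> / gmin) \<le> Min {
          ratio_powr ((1 - \<rho>) * \<gamma>) (4 * \<rho>m) (1 / \<gamma>),
          ereal ((1 - \<rho>) powr (1 / \<gamma>) / (4 * (1 + \<rho>t) * real (card (- S)))),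
          ratio_powr \<rho> (\<rho> + 2 powr (2 + \<gamma>) * \<rho>t * \<gamma> * \<kappa>) (1 / \<gamma>)} \<longrightarrow>
        linf_norm_on (- S) (xinf - g) / \<alpha>
          \<ge> hD D \<rho> - 2 * (\<rho> + 2 powr (2 + \<gamma>) * \<rho>t * \<gamma> * \<kappa>) / (\<gamma> * (1 - \<rho>) powr (1 / \<gamma> + 1))
                      * (\<alpha> / gmin) powr \<gamma>)"
proof -
  interpret L: bregman_l1 A y g D \<alpha> xinf
  proof
    have "0 \<in> {n. A *v n = 0}" by simp
    then show "nonzero_kernel A \<noteq> {}" using kernel_nontrivial by (auto simp: nonzero_kernel_def)
  qed (fact g_minimizer g_unique y_nonzero D_ge_3 \<alpha>_pos xinf_minimizer)+
  have gmin: "gmin = L.gmin" and \<gamma>: "\<gamma> = L.\<gamma>"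
    by (simp_all add: gmin_def L.gmin_def \<gamma>_def L.\<gamma>_def)
  have \<delta>: "(\<alpha> / gmin) powr \<gamma> = L.\<delta>" by (simp add: gmin \<gamma> L.\<delta>_def)
  have pos: "0 \<le> \<alpha> / gmin" "0 < \<gamma>" "0 \<le> \<rho>" "\<rho> < 1" "0 \<le> \<rho>m" "0 \<le> \<rho>t"
    using L.gmin_pos \<alpha>_pos L.gamma_bounds L.nsp_const_nonneg L.nsp_const_less_1
      L.nsp_const_minus_nonneg L.nsp_const_tilde_nonneg
    by (simp_all add: gmin \<gamma> \<rho>_def \<rho>m_def \<rho>t_def)
  have "gmin \<le> Max ((\<lambda>i. \<bar>g $ i\<bar>) ` supp g)"
  proof -
    obtain i where "i \<in> supp g" using L.supp_nonempty by auto
    then show ?thesis using L.gmin_le[of i] by (auto simp: gmin intro!: order_trans[OF _ Max_ge])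
  qed
  then have \<kappa>: "1 \<le> \<kappa>"
    using L.gmin_pos unfolding \<kappa>_def gmin_def[symmetric] gmin[symmetric] by simp
  \<comment> \<open>In product form the thresholds also cover \<open>\<rho>m = 0\<close> and a
    vanishing denominator in the third one.\<close>
  have thr1: "4 * \<rho>m * L.\<delta> \<le> (1 - \<rho>) * \<gamma>"
    if "ereal (\<alpha> / gmin) \<le> ratio_powr ((1 - \<rho>) * \<gamma>) (4 * \<rho>m) (1 / \<gamma>)"
    using mult_powr_le_of_le_ratio_powr[OF that] pos by (simp add: \<delta>)
  have thr3: "(\<rho> + 2 powr (2 + \<gamma>) * \<rho>t * \<gamma> * \<kappa>) * L.\<delta> \<le> \<rho>"
    if "ereal (\<alpha> / gmin) \<le> ratio_powr \<rho> (\<rho> + 2 powr (2 + \<gamma>) * \<rho>t * \<gamma> * \<kappa>) (1 / \<gamma>)"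
    using mult_powr_le_of_le_ratio_powr[OF that] pos \<kappa> by (simp add: \<delta>)
  show ?thesis
    unfolding \<delta> using L.upper_bound L.lower_bound[of \<kappa>] thr1 thr3 \<kappa>
    by (auto simp: gmin[symmetric] \<gamma>[symmetric] S_def \<rho>_def \<rho>m_def \<rho>t_def)
qed

end
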